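(* Let $D$ be a thick convex subset of a real linear space. Suppose that for every approximately Jensen function $f:D\to\mathbb{R}$ there is a Jensen function $a:D\to\mathbb{R}$ with $\sup_{x\in D}|f(x)-a(x)|<\infty$. Then there is a constant $J$, depending only on $D$, such that for every $\varepsilon$ and every $\varepsilon$-Jensen function $f:D\to\mathbb{R}$ there is a Jensen function $a:D\to\mathbb{R}$ with $\sup_{x\in D}|f(x)-a(x)|\le J\cdot\varepsilon$.
   Context: Let $D$ be a convex subset of a real linear space (no topology is assumed). A point $d\in D$ is geometrically interior to $D$ if for every $v$ in the linear space spanned by $D$ one has $d\pm tv\in D$ for all sufficiently small $t>0$. The convex set $D$ is thick if it has at least one geometrically interior point. A function $f:D\to\mathbb{R}$ is $\varepsilon$-Jensen if $\left|f\left(\frac{x+y}{2}\right)-\frac{f(x)+f(y)}{2}\right|\le\varepsilon$ for all $x,y\in D$; it is approximately Jensen if it is $\varepsilon$-Jensen for some $\varepsilon$, and Jensen if it is $0$-Jensen. *)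

theory Defs
  imports "HOL-Analysis.Analysis"
begin

definition geometrically_interior :: "'a::real_vector \<Rightarrow> 'a set \<Rightarrow> bool" where
  "geometrically_interior d D \<longleftrightarrow>
     d \<in> D \<and>
     (\<forall>v\<in>span D. \<forall>\<^sub>F t in at_right (0::real). d + t *\<^sub>R v \<in> D \<and> d - t *\<^sub>R v \<in> D)"

definition thick :: "'a::real_vector set \<Rightarrow> bool" where
  "thick D \<longleftrightarrow> (\<exists>d. geometrically_interior d D)"

text \<open>A function \<open>D \<rightarrow> \<real>\<close> is represented by a total function of which only the values
  on \<open>D\<close> matter.\<close>

definition eps_Jensen_on :: "'a::real_vector set \<Rightarrow> real \<Rightarrow> ('a \<Rightarrow> real) \<Rightarrow> bool" where
  "eps_Jensen_on D \<epsilon> f \<longleftrightarrow>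
     (\<forall>x\<in>D. \<forall>y\<in>D. \<bar>f ((1/2) *\<^sub>R (x + y)) - (f x + f y) / 2\<bar> \<le> \<epsilon>)"

definition approx_Jensen_on :: "'a::real_vector set \<Rightarrow> ('a \<Rightarrow> real) \<Rightarrow> bool" where
  "approx_Jensen_on D f \<longleftrightarrow> (\<exists>\<epsilon>. eps_Jensen_on D \<epsilon> f)"

definition Jensen_on :: "'a::real_vector set \<Rightarrow> ('a \<Rightarrow> real) \<Rightarrow> bool" where
  "Jensen_on D a \<longleftrightarrow> eps_Jensen_on D 0 a"

text \<open>The supremum is taken in the extended reals, so that it is \<open>\<infinity>\<close> when the difference is
  unbounded; the supremum of an unbounded set of reals would be an unspecified real number.\<close>

definition sup_dist_on :: "'a set \<Rightarrow> ('a \<Rightarrow> real) \<Rightarrow> ('a \<Rightarrow> real) \<Rightarrow> ereal" where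
  "sup_dist_on D f a = (SUP x\<in>D. ereal \<bar>f x - a x\<bar>)"

end

theory Submission
  imports Defs
begin

text \<open>
  The proof is an open mapping argument carried out by hand.  A Jensen function can be prescribed
  arbitrarily at an interior point \<open>d\<close> and at the points \<open>d + b\<close>, where \<open>b\<close> runs through a basis
  over the rationals. Subtracting the one that agrees with \<open>f\<close> there turns the \<open>1\<close>-Jensen
  functions into a pointwise bounded family, in which series with summable coefficients converge
  pointwise. If for no \<open>C\<close> every \<open>1\<close>-Jensen function were \<open>1/2\<close>-Jensen up to a correction
  bounded by \<open>C\<close>, a gliding hump \<open>\<Sum>n. 3\<^sup>-\<^sup>n f\<^sub>n\<close> of such functions would not be at finite distance
  from the Jensen functions. So there is such a \<open>C\<close>, and iterating the correction gives
  \<open>J = 2 C\<close>.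
\<close>

section \<open>Approximately Jensen functions\<close>

lemma eps_Jensen_onD:
  "eps_Jensen_on D e f \<Longrightarrow> x \<in> D \<Longrightarrow> y \<in> D \<Longrightarrow>
     \<bar>f ((1/2) *\<^sub>R (x + y)) - (f x + f y) / 2\<bar> \<le> e"
  by (auto simp: eps_Jensen_on_def)

lemma eps_Jensen_on_add:
  assumes "eps_Jensen_on D e f" "eps_Jensen_on D e' g"
  shows "eps_Jensen_on D (e + e') (\<lambda>x. f x + g x)"
  unfolding eps_Jensen_on_def
proof (intro ballI)
  fix x y assume "x \<in> D" "y \<in> D"
  from eps_Jensen_onD[OF assms(1) this] eps_Jensen_onD[OF assms(2) this]
  show "\<bar>f ((1/2) *\<^sub>R (x + y)) + g ((1/2) *\<^sub>R (x + y)) - (f x + g x + (f y + g y)) / 2\<bar> \<le> e + e'"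
    by (simp add: abs_le_iff field_simps)
qed

lemma eps_Jensen_on_scale:
  assumes "eps_Jensen_on D e f"
  shows "eps_Jensen_on D (\<bar>c\<bar> * e) (\<lambda>x. c * f x)"
  unfolding eps_Jensen_on_def
proof (intro ballI)
  fix x y assume "x \<in> D" "y \<in> D"
  have "\<bar>c * f ((1/2) *\<^sub>R (x + y)) - (c * f x + c * f y) / 2\<bar>
      = \<bar>c\<bar> * \<bar>f ((1/2) *\<^sub>R (x + y)) - (f x + f y) / 2\<bar>"
    by (simp add: abs_mult[symmetric] algebra_simps)
  also have "\<dots> \<le> \<bar>c\<bar> * e"
    using eps_Jensen_onD[OF assms \<open>x \<in> D\<close> \<open>y \<in> D\<close>] by (intro mult_left_mono) auto
  finally show "\<bar>c * f ((1/2) *\<^sub>R (x + y)) - (c * f x + c * f y) / 2\<bar> \<le> \<bar>c\<bar> * e" .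
qed

lemma eps_Jensen_on_diff:
  assumes "eps_Jensen_on D e f" "eps_Jensen_on D e' g"
  shows "eps_Jensen_on D (e + e') (\<lambda>x. f x - g x)"
  using eps_Jensen_on_add[OF assms(1) eps_Jensen_on_scale[OF assms(2), of "-1"]] by simp

lemma Jensen_on_diff:
  "Jensen_on D a \<Longrightarrow> Jensen_on D b \<Longrightarrow> Jensen_on D (\<lambda>x. a x - b x)"
  unfolding Jensen_on_def using eps_Jensen_on_diff[of D 0 a 0 b] by simp

lemma Jensen_on_scale: "Jensen_on D a \<Longrightarrow> Jensen_on D (\<lambda>x. c * a x)"
  unfolding Jensen_on_def using eps_Jensen_on_scale[of D 0 a c] by simp

lemma convex_midpoint:
  "convex D \<Longrightarrow> x \<in> D \<Longrightarrow> y \<in> D \<Longrightarrow> (1/2) *\<^sub>R (x + y) \<in> D"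
  using convexD[of D x y "1/2" "1/2"] by (simp add: scaleR_add_right)

lemma eps_Jensen_on_cong:
  assumes "convex D" "\<And>x. x \<in> D \<Longrightarrow> f x = g x"
  shows "eps_Jensen_on D e f \<longleftrightarrow> eps_Jensen_on D e g"
  using assms convex_midpoint[OF assms(1)] by (auto simp: eps_Jensen_on_def)

text \<open>Each instance of the inequality involves only three points of \<open>D\<close>, so
  pointwise convergence suffices. The constants may vary with \<open>n\<close>: below they shrink to
  0 or are partial sums of a geometric series.\<close>

lemma eps_Jensen_on_limit:
  assumes "convex D" and F: "\<And>n. eps_Jensen_on D (e n) (F n)"
    and f: "\<And>x. x \<in> D \<Longrightarrow> (\<lambda>n. F n x) \<longlonglongrightarrow> f x" and e: "e \<longlonglongrightarrow> e'"
  shows "eps_Jensen_on D e' f"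
  unfolding eps_Jensen_on_def
proof (intro ballI)
  fix x y assume xy: "x \<in> D" "y \<in> D"
  have "(\<lambda>n. \<bar>F n ((1/2) *\<^sub>R (x + y)) - (F n x + F n y) / 2\<bar>)
      \<longlonglongrightarrow> \<bar>f ((1/2) *\<^sub>R (x + y)) - (f x + f y) / 2\<bar>"
    by (intro tendsto_intros f xy convex_midpoint assms(1)) auto
  then show "\<bar>f ((1/2) *\<^sub>R (x + y)) - (f x + f y) / 2\<bar> \<le> e'"
    by (rule LIMSEQ_le[OF _ e]) (use eps_Jensen_onD[OF F xy] in auto)
qed

lemma eps_Jensen_on_sum:
  assumes "finite A" "\<And>k. k \<in> A \<Longrightarrow> eps_Jensen_on D (e k) (F k)"
  shows "eps_Jensen_on D (\<Sum>k\<in>A. e k) (\<lambda>x. \<Sum>k\<in>A. F k x)"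
  using assms
proof (induction A rule: finite_induct)
  case empty
  then show ?case by (simp add: eps_Jensen_on_def)
next
  case (insert k A)
  then show ?case using eps_Jensen_on_add[of D "e k" "F k"] by simp
qed

lemma sup_dist_on_le_iff:
  "sup_dist_on D f a \<le> ereal C \<longleftrightarrow> (\<forall>x\<in>D. \<bar>f x - a x\<bar> \<le> C)"
  by (simp add: sup_dist_on_def SUP_le_iff)

lemma sup_dist_on_finiteD:
  assumes "sup_dist_on D f a < \<infinity>"
  shows "\<exists>C. \<forall>x\<in>D. \<bar>f x - a x\<bar> \<le> C"
proof -
  obtain C where "sup_dist_on D f a \<le> ereal C"
    \<comment> \<open>The value minus infinity, taken when \<open>D\<close> is empty, is covered by
      the bound 0.\<close>
    using assms by (cases "sup_dist_on D f a") (auto intro: that[of 0])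
  then show ?thesis by (auto simp: sup_dist_on_le_iff)
qed

section \<open>Normalization on a rational basis\<close>

text \<open>A maximal rationally independent subset of \<open>V\<close> serves as \<open>B\<close>.
  The last conclusion says that \<open>V\<close> lies in the rational span of \<open>B\<close>,
  phrased as an induction principle. The scalars are rational because these are the ones that
  approximately Jensen functions respect up to bounded errors.\<close>

lemma rational_basis:
  fixes V :: "'a::real_vector set"
  obtains B where "B \<subseteq> V"
    and "\<forall>\<phi> :: 'a \<Rightarrow> real. \<exists>L. (\<forall>x y. L (x + y) = L x + L y) \<and> (\<forall>b\<in>B. L b = \<phi> b)"
    and "\<forall>P. P 0 \<longrightarrow> (\<forall>b\<in>B. P b) \<longrightarrow> (\<forall>x y. P x \<longrightarrow> P y \<longrightarrow> P (x + y)) \<longrightarrow>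
               (\<forall>q x. P x \<longrightarrow> P (of_rat q *\<^sub>R x)) \<longrightarrow> (\<forall>v\<in>V. P v)"
proof -
  interpret Q: vector_space_pair "\<lambda>q (x::'a). of_rat q *\<^sub>R x" "\<lambda>q (x::real). of_rat q *\<^sub>R x"
    by unfold_locales (auto simp: algebra_simps of_rat_add of_rat_mult)
  obtain B where B: "B \<subseteq> V" "Q.vs1.independent B" "V \<subseteq> Q.vs1.span B"
    using Q.vs1.maximal_independent_subset[of V] by blast
  show thesis
  proof (rule that[of B])
    show "B \<subseteq> V" by fact
    show "\<forall>\<phi> :: 'a \<Rightarrow> real. \<exists>L. (\<forall>x y. L (x + y) = L x + L y) \<and> (\<forall>b\<in>B. L b = \<phi> b)"
    proof
      fix \<phi> :: "'a \<Rightarrow> real"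
      from Q.linear_independent_extend[OF B(2), of \<phi>]
      show "\<exists>L. (\<forall>x y. L (x + y) = L x + L y) \<and> (\<forall>b\<in>B. L b = \<phi> b)"
        by (elim ex_forward) (simp add: Q.linear_add)
    qed
    show "\<forall>P. P 0 \<longrightarrow> (\<forall>b\<in>B. P b) \<longrightarrow> (\<forall>x y. P x \<longrightarrow> P y \<longrightarrow> P (x + y)) \<longrightarrow>
               (\<forall>q x. P x \<longrightarrow> P (of_rat q *\<^sub>R x)) \<longrightarrow> (\<forall>v\<in>V. P v)"
    proof (intro allI impI ballI)
      fix P v
      assume P: "P 0" "\<forall>b\<in>B. P b" "\<forall>x y. P x \<longrightarrow> P y \<longrightarrow> P (x + y)"
        "\<forall>q x. P x \<longrightarrow> P (of_rat q *\<^sub>R x)" and "v \<in> V"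
      then have "v \<in> Q.vs1.span B" using B(3) by blast
      then show "P v"
        by (rule Q.vs1.span_induct) (use P in \<open>auto simp: Q.vs1.subspace_def\<close>)
    qed
  qed
qed

section \<open>Bounds near an interior point, uniform over a family\<close>

lemma geometrically_interior_dyadic:
  assumes "geometrically_interior d D" "v \<in> span D"
  shows "\<forall>\<^sub>F N in sequentially. d + (1/2)^N *\<^sub>R v \<in> D"
proof -
  have "\<forall>\<^sub>F t in at_right (0::real). d + t *\<^sub>R v \<in> D"
    using assms by (auto simp: geometrically_interior_def elim: eventually_mono)
  moreover have "filterlim (\<lambda>N. (1/2::real)^N) (at_right 0) sequentially"
    unfolding filterlim_at by (auto intro!: LIMSEQ_power_zero)
  ultimately show ?thesis by (rule eventually_compose_filterlim)
qed

lemma additive_half: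
  fixes L :: "'a::real_vector \<Rightarrow> real"
  assumes "\<And>x y. L (x + y) = L x + L y"
  shows "L ((1/2) *\<^sub>R x) = L x / 2"
  using assms[of "(1/2) *\<^sub>R x" "(1/2) *\<^sub>R x"] by (simp add: scaleR_add_left[symmetric])

lemma Jensen_on_additive:
  fixes L :: "'a::real_vector \<Rightarrow> real"
  assumes L: "\<And>x y. L (x + y) = L x + L y"
  shows "Jensen_on D (\<lambda>x. L (x - d) + c)"
  unfolding Jensen_on_def eps_Jensen_on_def
proof (intro ballI)
  fix x y
  have "(1/2) *\<^sub>R (x + y) - d = (1/2) *\<^sub>R ((x - d) + (y - d))"
    by (simp add: algebra_simps flip: scaleR_add_left)
  then have "L ((1/2) *\<^sub>R (x + y) - d) = (L (x - d) + L (y - d)) / 2"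
    using additive_half[of L, OF L] L by simp
  then show "\<bar>L ((1/2) *\<^sub>R (x + y) - d) + c - (L (x - d) + c + (L (y - d) + c)) / 2\<bar> \<le> 0"
    by (simp add: field_simps)
qed

locale normalized_family =
  fixes D :: "'a::real_vector set" and d :: 'a and G :: "('a \<Rightarrow> real) set"
  assumes convex: "convex D" and interior: "geometrically_interior d D"
    and Jensen: "g \<in> G \<Longrightarrow> eps_Jensen_on D 1 g" and zero: "g \<in> G \<Longrightarrow> g d = 0"
begin

lemma base: "d \<in> D"
  using interior by (simp add: geometrically_interior_def)

text \<open>The point \<open>d + v\<close> may lie outside \<open>D\<close>, but its dyadic
  contractions towards \<open>d\<close> are eventually inside. Since \<open>C\<close> serves all
  \<open>g\<close> and all large \<open>N\<close>, bounded errors do no harm, and the tame vectors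
  form a rational vector space.\<close>

definition tame :: "'a \<Rightarrow> bool" where
  "tame v \<longleftrightarrow> v \<in> span D \<and> (\<exists>C. \<forall>\<^sub>F N in sequentially. \<forall>g\<in>G. \<bar>g (d + (1/2)^N *\<^sub>R v)\<bar> \<le> C)"

lemma half:
  assumes "g \<in> G" "d + v \<in> D"
  shows "\<bar>g (d + (1/2) *\<^sub>R v) - g (d + v) / 2\<bar> \<le> 1"
proof -
  have "(1/2) *\<^sub>R ((d + v) + d) = d + (1/2) *\<^sub>R v"
    by (simp add: algebra_simps flip: scaleR_add_left)
  then show ?thesis
    using eps_Jensen_onD[OF Jensen[OF assms(1)] assms(2) base] zero[OF assms(1)] by simp
qed

lemma dyadic_mem:
  assumes "d + v \<in> D" shows "d + (1/2)^N *\<^sub>R v \<in> D"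
proof -
  have "(1 - (1/2)^N) *\<^sub>R d + (1/2)^N *\<^sub>R (d + v) \<in> D"
    by (rule convexD[OF convex base assms]) (auto simp: power_le_one)
  then show ?thesis by (simp add: algebra_simps)
qed

lemma half_dyadic:
  assumes "g \<in> G" "d + (1/2)^N *\<^sub>R v \<in> D"
  shows "\<bar>g (d + (1/2)^Suc N *\<^sub>R v) - g (d + (1/2)^N *\<^sub>R v) / 2\<bar> \<le> 1"
  using half[OF assms] by simp

text \<open>The point of level \<open>Suc N\<close> in direction \<open>u + v\<close> is the
  midpoint of the points of level \<open>N\<close> in directions \<open>u\<close> and
  \<open>v\<close>. Replacing half of each endpoint value by the value at level \<open>Suc N\<close>
  costs 1, since \<open>g d = 0\<close>; with the midpoint error this makes 3.\<close>

lemma approx_additive: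
  assumes u: "u \<in> span D" and v: "v \<in> span D"
  shows "\<forall>\<^sub>F N in sequentially. \<forall>g\<in>G.
    \<bar>g (d + (1/2)^N *\<^sub>R (u + v)) - g (d + (1/2)^N *\<^sub>R u) - g (d + (1/2)^N *\<^sub>R v)\<bar> \<le> 3"
proof -
  have "\<forall>\<^sub>F N in sequentially. d + (1/2)^N *\<^sub>R u \<in> D \<and> d + (1/2)^N *\<^sub>R v \<in> D"
    using geometrically_interior_dyadic[OF interior u] geometrically_interior_dyadic[OF interior v]
    by (rule eventually_conj)
  then have "\<forall>\<^sub>F N in sequentially. \<forall>g\<in>G.
    \<bar>g (d + (1/2)^Suc N *\<^sub>R (u + v)) - g (d + (1/2)^Suc N *\<^sub>R u)
       - g (d + (1/2)^Suc N *\<^sub>R v)\<bar> \<le> 3"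
  proof (rule eventually_mono, intro ballI)
    fix N g assume *: "d + (1/2)^N *\<^sub>R u \<in> D \<and> d + (1/2)^N *\<^sub>R v \<in> D" and g: "g \<in> G"
    have eq: "(1/2) *\<^sub>R ((d + (1/2)^N *\<^sub>R u) + (d + (1/2)^N *\<^sub>R v)) = d + (1/2)^Suc N *\<^sub>R (u + v)"
      by (simp add: algebra_simps flip: scaleR_add_left)
    have combine: "\<bar>m - p - q\<bar> \<le> 3"
      if "\<bar>m - (p' + q') / 2\<bar> \<le> 1" "\<bar>p - p' / 2\<bar> \<le> 1" "\<bar>q - q' / 2\<bar> \<le> 1"
      for m p q p' q' :: real
      using that by (simp add: abs_le_iff field_simps)
    show "\<bar>g (d + (1/2)^Suc N *\<^sub>R (u + v)) - g (d + (1/2)^Suc N *\<^sub>R u)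
       - g (d + (1/2)^Suc N *\<^sub>R v)\<bar> \<le> 3"
      using eps_Jensen_onD[OF Jensen[OF g] conjunct1[OF *] conjunct2[OF *], unfolded eq]
        half_dyadic[OF g conjunct1[OF *]] half_dyadic[OF g conjunct2[OF *]]
      by (rule combine)
  qed
  then show ?thesis
    by (subst (asm) eventually_sequentially_Suc)
qed

lemma tame_0: "tame 0"
  unfolding tame_def by (auto intro!: exI[of _ 0] always_eventually simp: zero span_zero)

lemma tame_add:
  assumes "tame u" "tame v"
  shows "tame (u + v)"
proof -
  obtain A B where
    AB: "\<forall>\<^sub>F N in sequentially. \<forall>g\<in>G. \<bar>g (d + (1/2)^N *\<^sub>R u)\<bar> \<le> A"
    "\<forall>\<^sub>F N in sequentially. \<forall>g\<in>G. \<bar>g (d + (1/2)^N *\<^sub>R v)\<bar> \<le> B"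
    and uv: "u \<in> span D" "v \<in> span D"
    using assms by (auto simp: tame_def)
  from AB approx_additive[OF uv]
  have "\<forall>\<^sub>F N in sequentially. \<forall>g\<in>G. \<bar>g (d + (1/2)^N *\<^sub>R (u + v))\<bar> \<le> A + B + 3"
    by eventually_elim fastforce
  then show ?thesis using uv by (auto simp: tame_def span_add)
qed

lemma tame_neg:
  assumes "tame v"
  shows "tame (- v)"
proof -
  obtain A where A:
    "\<forall>\<^sub>F N in sequentially. \<forall>g\<in>G. \<bar>g (d + (1/2)^N *\<^sub>R v)\<bar> \<le> A" and v: "v \<in> span D"
    using assms by (auto simp: tame_def)
  have "- v \<in> span D" using v by (rule span_neg)
  \<comment> \<open>The two directions sum to 0, where every \<open>g\<close> takes the value
    \<open>g d = 0\<close>.\<close>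
  from A approx_additive[OF v this]
  have "\<forall>\<^sub>F N in sequentially. \<forall>g\<in>G. \<bar>g (d + (1/2)^N *\<^sub>R (- v))\<bar> \<le> A + 3"
    by eventually_elim (fastforce simp: zero)
  then show ?thesis using \<open>- v \<in> span D\<close> by (auto simp: tame_def)
qed

lemma tame_of_nat: "tame v \<Longrightarrow> tame (real n *\<^sub>R v)"
  by (induction n) (auto simp: tame_0 scaleR_add_left intro: tame_add)

lemma tame_of_int: 
  assumes "tame v" shows "tame (real_of_int k *\<^sub>R v)"
proof (cases k)
  case (nonneg n)
  then show ?thesis using tame_of_nat[OF assms, of n] by simp
next
  case (neg n)
  then have "real_of_int k *\<^sub>R v = - (real (Suc n) *\<^sub>R v)" by (simp flip: scaleR_minus_left)
  then show ?thesis using tame_neg[OF tame_of_nat[OF assms]] by metis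
qed

lemma approx_multiple:
  assumes w: "w \<in> span D"
  shows "\<forall>\<^sub>F N in sequentially. \<forall>g\<in>G.
    \<bar>g (d + (1/2)^N *\<^sub>R (real j *\<^sub>R w)) - real j * g (d + (1/2)^N *\<^sub>R w)\<bar> \<le> 3 * real j"
proof (induction j)
  case 0
  then show ?case by (simp add: zero)
next
  case (Suc j)
  have "real j *\<^sub>R w \<in> span D" using w by (rule span_scale)
  from Suc approx_additive[OF this w] show ?case
  proof (eventually_elim, intro ballI)
    fix N g assume g: "g \<in> G"
      and 1: "\<forall>g\<in>G. \<bar>g (d + (1/2)^N *\<^sub>R (real j *\<^sub>R w)) - real j * g (d + (1/2)^N *\<^sub>R w)\<bar> \<le> 3 * real j"
      and 2: "\<forall>g\<in>G. \<bar>g (d + (1/2)^N *\<^sub>R (real j *\<^sub>R w + w)) - g (d + (1/2)^N *\<^sub>R (real j *\<^sub>R w))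
         - g (d + (1/2)^N *\<^sub>R w)\<bar> \<le> 3"
    have eq: "real (Suc j) *\<^sub>R w = real j *\<^sub>R w + w" by (simp add: algebra_simps)
    have "real (Suc j) * g (d + (1/2)^N *\<^sub>R w)
        = real j * g (d + (1/2)^N *\<^sub>R w) + g (d + (1/2)^N *\<^sub>R w)"
      by (simp add: algebra_simps)
    then show "\<bar>g (d + (1/2)^N *\<^sub>R (real (Suc j) *\<^sub>R w)) - real (Suc j) * g (d + (1/2)^N *\<^sub>R w)\<bar>
        \<le> 3 * real (Suc j)"
      unfolding eq using bspec[OF 1 g] bspec[OF 2 g] by simp
  qed
qed

text \<open>Along \<open>v\<close> the value of \<open>g\<close> is \<open>m\<close> times its value
  along \<open>w = v / m\<close>, up to \<open>3 * m\<close>. As \<open>m\<close> is at least 1, a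
  bound on \<open>m * g\<close> also bounds \<open>g\<close>.\<close>

lemma tame_divide:
  assumes "tame v" "m > 0"
  shows "tame ((1 / real m) *\<^sub>R v)"
proof -
  obtain A where A:
    "\<forall>\<^sub>F N in sequentially. \<forall>g\<in>G. \<bar>g (d + (1/2)^N *\<^sub>R v)\<bar> \<le> A" and v: "v \<in> span D"
    using assms by (auto simp: tame_def)
  define w where "w = (1 / real m) *\<^sub>R v"
  have w: "w \<in> span D" unfolding w_def using v by (rule span_scale)
  have mw: "real m *\<^sub>R w = v" using assms(2) by (simp add: w_def)
  from approx_multiple[OF w, of m] A
  have "\<forall>\<^sub>F N in sequentially. \<forall>g\<in>G. \<bar>g (d + (1/2)^N *\<^sub>R w)\<bar> \<le> A + 3 * real m"
    unfolding mw
  proof (eventually_elim, intro ballI)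
    fix N g assume g: "g \<in> G"
      and 1: "\<forall>g\<in>G. \<bar>g (d + (1/2)^N *\<^sub>R v) - real m * g (d + (1/2)^N *\<^sub>R w)\<bar> \<le> 3 * real m"
      and 2: "\<forall>g\<in>G. \<bar>g (d + (1/2)^N *\<^sub>R v)\<bar> \<le> A"
    have "\<bar>g (d + (1/2)^N *\<^sub>R w)\<bar> \<le> real m * \<bar>g (d + (1/2)^N *\<^sub>R w)\<bar>"
      using assms(2) by (simp add: mult_le_cancel_right1)
    also have "\<dots> = \<bar>real m * g (d + (1/2)^N *\<^sub>R w)\<bar>" by (simp add: abs_mult)
    also have "\<dots> \<le> A + 3 * real m" using bspec[OF 1 g] bspec[OF 2 g] by linarith
    finally show "\<bar>g (d + (1/2)^N *\<^sub>R w)\<bar> \<le> A + 3 * real m" .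
  qed
  then show ?thesis using w by (auto simp: tame_def w_def)
qed

lemma tame_of_rat:
  assumes "tame v"
  shows "tame (of_rat q *\<^sub>R v)"
proof -
  obtain k m where q: "q = Fract k m" "m > 0" by (cases q) auto
  have "tame ((1 / real (nat m)) *\<^sub>R (real_of_int k *\<^sub>R v))"
    using q(2) by (intro tame_divide tame_of_int assms) auto
  then show ?thesis using q by (simp add: of_rat_rat)
qed

text \<open>Halving towards \<open>d\<close> turns a bound \<open>t\<close> into
  \<open>t / 2 + 1\<close>. The fixed point of this recursion is 2, so a sequence starting at 0
  never exceeds 2.\<close>

lemma tame_zero_point:
  assumes v: "d + v \<in> D" and z: "\<And>g. g \<in> G \<Longrightarrow> g (d + v) = 0"
  shows "tame v"
proof -
  have "v \<in> span D"
    using span_diff[OF span_base[OF v] span_base[OF base]] by simp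
  moreover have "\<bar>g (d + (1/2)^N *\<^sub>R v)\<bar> \<le> 2" if g: "g \<in> G" for g N
  proof (induction N)
    case 0
    then show ?case by (simp add: z g)
  next
    case (Suc N)
    then show ?case using half_dyadic[OF g dyadic_mem[OF v, of N]] by linarith
  qed
  ultimately show ?thesis by (auto simp: tame_def intro!: exI[of _ 2])
qed

text \<open>The halving estimate is run backwards from level \<open>N\<close> to level 0: a bound
  \<open>C\<close> at one level gives \<open>2 * C + 2\<close> at the previous one. The number of
  steps is the same for all \<open>g\<close>, so the bound stays uniform.\<close>

lemma tame_bounded:
  assumes "tame v" and v: "d + v \<in> D"
  shows "\<exists>C. \<forall>g\<in>G. \<bar>g (d + v)\<bar> \<le> C"
proof -
  obtain A N where A: "\<forall>g\<in>G. \<bar>g (d + (1/2)^N *\<^sub>R v)\<bar> \<le> A"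
    using assms(1) by (auto simp: tame_def eventually_sequentially)
  have "\<exists>C. \<forall>g\<in>G. \<bar>g (d + (1/2)^(N - k) *\<^sub>R v)\<bar> \<le> C" if "k \<le> N" for k
    using that
  proof (induction k)
    case 0
    then show ?case using A by auto
  next
    case (Suc k)
    then obtain C where C: "\<forall>g\<in>G. \<bar>g (d + (1/2)^(N - k) *\<^sub>R v)\<bar> \<le> C" by auto
    have Nk: "N - k = Suc (N - Suc k)" using Suc.prems by simp
    have "\<bar>g (d + (1/2)^(N - Suc k) *\<^sub>R v)\<bar> \<le> 2 * C + 2" if g: "g \<in> G" for g
      using half_dyadic[OF g dyadic_mem[OF v, of "N - Suc k"]] bspec[OF C g] unfolding Nk
      by linarith
    then show ?case by blast
  qed
  from this[of N] show ?thesis by simp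
qed

end

text \<open>The function \<open>K\<close> is chosen before \<open>f\<close>; this is the pointwise
  boundedness that makes the later series converge. Normalized functions vanish at \<open>d\<close>
  and at all \<open>d + b\<close>, so the basis vectors are tame, and with them all of
  \<open>D - d\<close>.\<close>

lemma Jensen_normalization:
  assumes "convex D" "thick D"
  shows "\<exists>K. \<forall>f. eps_Jensen_on D 1 f \<longrightarrow>
     (\<exists>a. Jensen_on D a \<and> (\<forall>x\<in>D. \<bar>f x - a x\<bar> \<le> K x))"
proof -
  obtain d where d: "geometrically_interior d D" using assms(2) by (auto simp: thick_def)
  obtain B where B: "B \<subseteq> (\<lambda>x. x - d) ` D"
    and ext: "\<forall>\<phi> :: 'a \<Rightarrow> real. \<exists>L. (\<forall>x y. L (x + y) = L x + L y) \<and> (\<forall>b\<in>B. L b = \<phi> b)"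
    and ind: "\<forall>P. P 0 \<longrightarrow> (\<forall>b\<in>B. P b) \<longrightarrow> (\<forall>x y. P x \<longrightarrow> P y \<longrightarrow> P (x + y)) \<longrightarrow>
        (\<forall>q x. P x \<longrightarrow> P (of_rat q *\<^sub>R x)) \<longrightarrow> (\<forall>v\<in>(\<lambda>x. x - d) ` D. P v)"
    by (rule rational_basis[of "(\<lambda>x. x - d) ` D"])
  define G where "G = {g. eps_Jensen_on D 1 g \<and> g d = 0 \<and> (\<forall>b\<in>B. g (d + b) = 0)}"
  interpret normalized_family D d G
    by unfold_locales (use assms d in \<open>auto simp: G_def\<close>)
  have "\<exists>C. \<forall>g\<in>G. \<bar>g x\<bar> \<le> C" if x: "x \<in> D" for x
  proof -
    have "tame (x - d)"
    proof -
      have "tame b" if "b \<in> B" for b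
        using that B by (intro tame_zero_point) (auto simp: G_def)
      then have "\<forall>v\<in>(\<lambda>x. x - d) ` D. tame v"
        using spec[OF ind, of tame] tame_0 tame_add tame_of_rat by simp
      then show ?thesis using x by blast
    qed
    from tame_bounded[OF this] x show ?thesis by simp
  qed
  then obtain K where K: "\<And>x g. x \<in> D \<Longrightarrow> g \<in> G \<Longrightarrow> \<bar>g x\<bar> \<le> K x" by metis
  have "\<exists>a. Jensen_on D a \<and> (\<forall>x\<in>D. \<bar>f x - a x\<bar> \<le> K x)" if f: "eps_Jensen_on D 1 f" for f
  proof -
    obtain L where L: "\<And>x y. L (x + y) = L x + L y" and Lb: "\<And>b. b \<in> B \<Longrightarrow> L b = f (d + b) - f d"
      using spec[OF ext, of "\<lambda>b. f (d + b) - f d"] by blast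
    \<comment> \<open>This function agrees with \<open>f\<close> at \<open>d\<close> and at every
      \<open>d + b\<close>, so \<open>f - a\<close> lies in \<open>G\<close>.\<close>
    define a where "a = (\<lambda>x. L (x - d) + f d)"
    have a: "Jensen_on D a" unfolding a_def using L by (rule Jensen_on_additive)
    have "L 0 = 0" using L[of 0 0] by simp
    then have "(\<lambda>x. f x - a x) \<in> G"
      using eps_Jensen_on_diff[OF f a[unfolded Jensen_on_def]] by (simp add: G_def a_def Lb)
    from K[OF _ this] a show ?thesis by blast
  qed
  then show ?thesis by blast
qed

section \<open>The open mapping argument\<close>

text \<open>A correction bounded by \<open>C\<close> halves the Jensen constant, and doubling the
  residual restores the constant 1, so the step can be repeated. The \<open>n\<close>-th correction
  enters with weight \<open>(1/2)^n\<close>, which gives the total \<open>2 * C\<close>.\<close>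

lemma iterated_correction:
  fixes C :: real
  assumes "convex D"
    and C: "\<And>f. eps_Jensen_on D 1 f \<Longrightarrow>
        \<exists>b. (\<forall>x\<in>D. \<bar>b x\<bar> \<le> C) \<and> eps_Jensen_on D (1/2) (\<lambda>x. f x - b x)"
    and f: "eps_Jensen_on D 1 f"
  shows "\<exists>a. Jensen_on D a \<and> (\<forall>x\<in>D. \<bar>f x - a x\<bar> \<le> 2 * C)"
proof -
  obtain \<beta> where \<beta>: "\<And>f x. eps_Jensen_on D 1 f \<Longrightarrow> x \<in> D \<Longrightarrow> \<bar>\<beta> f x\<bar> \<le> C"
    "\<And>f. eps_Jensen_on D 1 f \<Longrightarrow> eps_Jensen_on D (1/2) (\<lambda>x. f x - \<beta> f x)"
    using C by metis
  \<comment> \<open>\<open>R n\<close> is the residual after \<open>n\<close> corrections, magnified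
    by \<open>2^n\<close>.\<close>
  define R where "R = rec_nat f (\<lambda>n r x. 2 * (r x - \<beta> r x))"
  have R0: "R 0 = f" and RS: "R (Suc n) = (\<lambda>x. 2 * (R n x - \<beta> (R n) x))" for n
    by (simp_all add: R_def)
  have R: "eps_Jensen_on D 1 (R n)" for n
  proof (induction n)
    case (Suc n)
    then show ?case unfolding RS using eps_Jensen_on_scale[OF \<beta>(2)[OF Suc], of 2] by simp
  qed (simp add: R0 f)
  define b where "b = (\<lambda>n. \<beta> (R n))"
  have b: "\<bar>b n x\<bar> \<le> C" if "x \<in> D" for n x
    unfolding b_def using that by (intro \<beta> R)
  have norm_b: "norm ((1/2)^n * b n x) \<le> (1/2)^n * C" if "x \<in> D" for n x
    using b[OF that, of n] by (simp add: abs_mult)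
  have geo: "(\<lambda>n. (1/2)^n * C) sums (2 * C)"
    using sums_mult2[OF geometric_sums[of "1/2::real"], of C] by simp
  have summ: "summable (\<lambda>n. norm ((1/2)^n * b n x))" if "x \<in> D" for x
    by (rule summable_comparison_test'[OF sums_summable[OF geo]]) (use norm_b[OF that] in simp)
  have rem: "(1/2)^n * R n x = f x - (\<Sum>k<n. (1/2)^k * b k x)" for n x
  proof (induction n)
    case (Suc n)
    have "(1/2)^Suc n * R (Suc n) x = (1/2)^n * R n x - (1/2)^n * b n x"
      by (simp add: RS b_def algebra_simps)
    then show ?case using Suc by simp
  qed (simp add: R0)
  define s where "s = (\<lambda>x. \<Sum>n. (1/2)^n * b n x)"
  \<comment> \<open>The true residuals \<open>(1/2)^n * R n\<close> are
    \<open>(1/2)^n\<close>-Jensen and tend pointwise to \<open>f - s\<close>.\<close>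
  have "eps_Jensen_on D 0 (\<lambda>x. f x - s x)"
  proof (rule eps_Jensen_on_limit[OF assms(1)])
    show "eps_Jensen_on D ((1/2)^n) (\<lambda>x. (1/2)^n * R n x)" for n
      using eps_Jensen_on_scale[OF R, of "(1/2)^n" n] by simp
    show "(\<lambda>n. (1/2)^n * R n x) \<longlonglongrightarrow> f x - s x" if "x \<in> D" for x
      unfolding rem s_def
      by (intro tendsto_intros summable_LIMSEQ summable_norm_cancel[OF summ[OF that]])
    show "(\<lambda>n. (1/2::real)^n) \<longlonglongrightarrow> 0" by (rule LIMSEQ_power_zero) simp
  qed
  moreover have "\<bar>s x\<bar> \<le> 2 * C" if "x \<in> D" for x
  proof -
    have "\<bar>s x\<bar> \<le> (\<Sum>n. (1/2)^n * C)"
      using norm_suminf_le[OF norm_b[OF that] sums_summable[OF geo]] by (simp add: s_def)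
    then show ?thesis using geo by (simp add: sums_unique[symmetric])
  qed
  ultimately show ?thesis
    unfolding Jensen_on_def by (intro exI[of _ "\<lambda>x. f x - s x"]) simp
qed

section \<open>The gliding hump\<close>

lemma pointwise_bounded_series:
  fixes g :: "nat \<Rightarrow> 'a::real_vector \<Rightarrow> real"
  assumes "convex D" and g: "\<And>n. eps_Jensen_on D 1 (g n)"
    and K: "\<And>n x. x \<in> D \<Longrightarrow> \<bar>g n x\<bar> \<le> K x"
  shows "\<And>x. x \<in> D \<Longrightarrow> summable (\<lambda>n. (1/3)^n * g n x)"
    and "eps_Jensen_on D (3/2) (\<lambda>x. \<Sum>n. (1/3)^n * g n x)"
proof -
  \<comment> \<open>At a fixed \<open>x\<close> the bound \<open>K x\<close> is a constant, so a
    geometric series dominates.\<close>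
  show summ: "summable (\<lambda>n. (1/3)^n * g n x)" if "x \<in> D" for x
  proof (rule summable_comparison_test')
    show "summable (\<lambda>n. (1/3)^n * K x)" by (intro summable_mult2 summable_geometric) simp
    show "norm ((1/3)^n * g n x) \<le> (1/3)^n * K x" if "n \<ge> 0" for n
      using K[OF \<open>x \<in> D\<close>, of n] by (simp add: abs_mult)
  qed
  show "eps_Jensen_on D (3/2) (\<lambda>x. \<Sum>n. (1/3)^n * g n x)"
  proof (rule eps_Jensen_on_limit[OF assms(1)])
    show "eps_Jensen_on D (\<Sum>k<n. (1/3)^k) (\<lambda>x. \<Sum>k<n. (1/3)^k * g k x)" for n
      by (rule eps_Jensen_on_sum) (use eps_Jensen_on_scale[OF g, of "(1/3)^k" k for k] in auto)
    show "(\<lambda>n. \<Sum>k<n. (1/3)^k * g k x) \<longlonglongrightarrow> (\<Sum>n. (1/3)^n * g n x)" if "x \<in> D" for x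
      by (rule summable_LIMSEQ[OF summ[OF that]])
    \<comment> \<open>The Jensen constants of the terms add up to the geometric sum 3/2.\<close>
    show "(\<lambda>n. \<Sum>k<n. (1/3::real)^k) \<longlonglongrightarrow> 3/2"
      using geometric_sums[of "1/3::real"] by (simp add: sums_def)
  qed
qed

text \<open>The ratio 1/3 is chosen so that, after magnifying by \<open>3^n\<close>, everything
  beyond the \<open>n\<close>-th hump has Jensen constant \<open>(1/3) * (3/2) = 1/2\<close>,
  exactly the constant that a correction is allowed to leave.\<close>

lemma uniform_half_correction:
  assumes "convex D" "thick D"
    and near: "\<And>f. approx_Jensen_on D f \<Longrightarrow> \<exists>a C. Jensen_on D a \<and> (\<forall>x\<in>D. \<bar>f x - a x\<bar> \<le> C)"
  shows "\<exists>C. \<forall>f. eps_Jensen_on D 1 f \<longrightarrow>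
    (\<exists>b. (\<forall>x\<in>D. \<bar>b x\<bar> \<le> C) \<and> eps_Jensen_on D (1/2) (\<lambda>x. f x - b x))"
proof (rule ccontr)
  assume "\<not> ?thesis"
  then obtain \<psi> where \<psi>: "\<And>C::real. eps_Jensen_on D 1 (\<psi> C)"
    and \<psi>': "\<And>C b. \<forall>x\<in>D. \<bar>b x\<bar> \<le> C \<Longrightarrow> \<not> eps_Jensen_on D (1/2) (\<lambda>x. \<psi> C x - b x)"
    by metis
  obtain K where K: "\<And>f. eps_Jensen_on D 1 f \<Longrightarrow>
     \<exists>a. Jensen_on D a \<and> (\<forall>x\<in>D. \<bar>f x - a x\<bar> \<le> K x)"
    using Jensen_normalization[OF assms(1,2)] by blast
  obtain \<alpha> where \<alpha>: "\<And>C. Jensen_on D (\<alpha> C)"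
    and \<alpha>K: "\<And>C x. x \<in> D \<Longrightarrow> \<bar>\<psi> C x - \<alpha> C x\<bar> \<le> K x"
    using K[OF \<psi>] by metis
  \<comment> \<open>Subtracting a Jensen function keeps \<open>\<phi> C\<close> a counterexample for
    \<open>C\<close>, and now \<open>K\<close> bounds all of them pointwise.\<close>
  define \<phi> where "\<phi> C x = \<psi> C x - \<alpha> C x" for C x
  have \<phi>: "eps_Jensen_on D 1 (\<phi> C)" for C
    using eps_Jensen_on_diff[OF \<psi> \<alpha>[unfolded Jensen_on_def]] by (simp add: \<phi>_def[abs_def])
  have \<phi>': False
    if b: "\<forall>x\<in>D. \<bar>b x\<bar> \<le> C" and "eps_Jensen_on D (1/2) (\<lambda>x. \<phi> C x - b x)" for C b
  proof -
    have "eps_Jensen_on D (1/2) (\<lambda>x. \<psi> C x - b x)"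
      using eps_Jensen_on_add[OF that(2) \<alpha>[of C, unfolded Jensen_on_def]]
      by (simp add: \<phi>_def algebra_simps)
    then show False using \<psi>'[OF b] by blast
  qed
  obtain A M where A: "\<And>f. approx_Jensen_on D f \<Longrightarrow> Jensen_on D (A f)"
    and M: "\<And>f x. approx_Jensen_on D f \<Longrightarrow> x \<in> D \<Longrightarrow> \<bar>f x - A f x\<bar> \<le> M f"
    using near by metis
  \<comment> \<open>The recursion carries the whole partial sum, because the next hump must defeat a
    bound that involves the distance \<open>M (S n)\<close> of that sum from a Jensen
    function.\<close>
  define S where "S = rec_nat (\<lambda>x. 0) (\<lambda>n s x. s x + (1/3)^n * \<phi> (3^n * (real n + M s)) x)"
  define c where "c n = 3^n * (real n + M (S n))" for n
  define g where "g n = \<phi> (c n)" for n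
  have S: "S n = (\<lambda>x. \<Sum>k<n. (1/3)^k * g k x)" for n
    by (induction n) (simp_all add: S_def g_def c_def)
  have g: "eps_Jensen_on D 1 (g n)" for n
    unfolding g_def by (rule \<phi>)
  have gK: "\<bar>g n x\<bar> \<le> K x" if "x \<in> D" for n x
    using \<alpha>K[OF that] by (simp add: g_def \<phi>_def)
  have S_approx: "approx_Jensen_on D (S n)" for n
    unfolding approx_Jensen_on_def S
    by (intro exI[of _ "\<Sum>k<n. (1/3)^k"] eps_Jensen_on_sum)
       (use eps_Jensen_on_scale[OF g, of "(1/3)^k" k for k] in auto)
  define F where "F x = (\<Sum>n. (1/3)^n * g n x)" for x
  have F: "approx_Jensen_on D F"
    using pointwise_bounded_series(2)[OF assms(1), of g, OF g gK] 
    unfolding approx_Jensen_on_def F_def[abs_def] by blast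
  \<comment> \<open>\<open>F\<close> is known only after all humps are chosen; the term
    \<open>real n\<close> in \<open>c n\<close> grows so that it eventually exceeds the distance
    \<open>M F\<close>.\<close>
  obtain n where n: "M F \<le> real n" using real_arch_simple by blast
  \<comment> \<open>This is the tail after the \<open>n\<close>-th hump, rescaled to have leading
    weight 1.\<close>
  define T where "T x = (\<Sum>k. (1/3)^k * g (k + Suc n) x)" for x
  have T: "eps_Jensen_on D (3/2) T"
    using pointwise_bounded_series(2)[OF assms(1), of "\<lambda>k. g (k + Suc n)", OF g gK]
    by (simp add: T_def[abs_def])
  have split: "3^n * (F x - S n x) = g n x + (1/3) * T x" if x: "x \<in> D" for x
  proof -
    have "F x = (\<Sum>k. (1/3)^(k + Suc n) * g (k + Suc n) x) + (\<Sum>k<Suc n. (1/3)^k * g k x)"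
      unfolding F_def
      by (rule suminf_split_initial_segment[OF pointwise_bounded_series(1)[OF assms(1) g gK x]])
    also have "(\<lambda>k. (1/3)^(k + Suc n) * g (k + Suc n) x)
        = (\<lambda>k. (1/3)^Suc n * ((1/3)^k * g (k + Suc n) x))"
      by (simp add: power_add mult_ac)
    also have "(\<Sum>k. (1/3)^Suc n * ((1/3)^k * g (k + Suc n) x)) = (1/3)^Suc n * T x"
      unfolding T_def
      by (rule suminf_mult)
         (rule pointwise_bounded_series(1)[OF assms(1), of "\<lambda>k. g (k + Suc n)", OF g gK x])
    finally show ?thesis by (simp add: S field_simps)
  qed
  \<comment> \<open>The correction \<open>b\<close> is the magnified difference of the bounded
    errors of \<open>F\<close> and \<open>S n\<close>, hence at most \<open>c n\<close>. Subtracting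
    it from the \<open>n\<close>-th hump leaves a Jensen function minus \<open>T / 3\<close>, which
    is \<open>1/2\<close>-Jensen, against the choice of the hump.\<close>
  define b where "b x = 3^n * ((F x - A F x) - (S n x - A (S n) x))" for x
  show False
  proof (rule \<phi>')
    show "\<forall>x\<in>D. \<bar>b x\<bar> \<le> c n"
    proof
      fix x assume "x \<in> D"
      then have "\<bar>(F x - A F x) - (S n x - A (S n) x)\<bar> \<le> real n + M (S n)"
        using M[OF F] M[OF S_approx, of x n] n by fastforce
      then show "\<bar>b x\<bar> \<le> c n" by (simp add: b_def c_def abs_mult)
    qed
    have "eps_Jensen_on D (1/2)
        (\<lambda>x. 3^n * (A F x - A (S n) x) - (1/3) * T x)"
      using eps_Jensen_on_diff[OF
          Jensen_on_scale[OF Jensen_on_diff[OF A[OF F] A[OF S_approx[of n]]], unfolded Jensen_on_def]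
          eps_Jensen_on_scale[OF T, of "1/3"], of "3^n"] by simp
    moreover have "\<phi> (c n) x - b x = 3^n * (A F x - A (S n) x) - (1/3) * T x" if "x \<in> D" for x
      using split[OF that] by (simp add: b_def g_def algebra_simps)
    ultimately show "eps_Jensen_on D (1/2) (\<lambda>x. \<phi> (c n) x - b x)"
      by (subst eps_Jensen_on_cong[OF assms(1)])
  qed
qed

theorem theorem3:
  fixes D :: "'a::real_vector set"
  assumes "convex D" and "thick D"
    and "\<And>f. approx_Jensen_on D f \<Longrightarrow> \<exists>a. Jensen_on D a \<and> sup_dist_on D f a < \<infinity>"
  shows "\<exists>J::real. \<forall>\<epsilon>::real. \<forall>f. eps_Jensen_on D \<epsilon> f \<longrightarrow>
           (\<exists>a. Jensen_on D a \<and> sup_dist_on D f a \<le> ereal (J * \<epsilon>))"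
proof -
  obtain d where d: "d \<in> D"
    using assms(2) by (auto simp: thick_def geometrically_interior_def)
  obtain C where C: "\<And>f. eps_Jensen_on D 1 f \<Longrightarrow>
      \<exists>b. (\<forall>x\<in>D. \<bar>b x\<bar> \<le> C) \<and> eps_Jensen_on D (1/2) (\<lambda>x. f x - b x)"
    using uniform_half_correction[OF assms(1,2)] assms(3) sup_dist_on_finiteD by metis
  have "\<exists>a. Jensen_on D a \<and> (\<forall>x\<in>D. \<bar>f x - a x\<bar> \<le> 2 * C * \<epsilon>)"
    if f: "eps_Jensen_on D \<epsilon> f" for \<epsilon> f
  proof -
    \<comment> \<open>A point of \<open>D\<close> rules out negative constants. The value 0 is
      treated apart because \<open>f\<close> is otherwise divided by
      \<open>\<epsilon>\<close>.\<close>
    have "0 \<le> \<epsilon>"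
      using eps_Jensen_onD[OF f d d] by linarith
    then consider "\<epsilon> = 0" | "\<epsilon> > 0" by linarith
    then show ?thesis
    proof cases
      case 1
      then show ?thesis using f by (auto simp: Jensen_on_def)
    next
      case 2
      have "eps_Jensen_on D 1 (\<lambda>x. (1/\<epsilon>) * f x)"
        using eps_Jensen_on_scale[OF f, of "1/\<epsilon>"] 2 by simp
      from iterated_correction[OF assms(1) C this]
      obtain a where a: "Jensen_on D a" "\<And>x. x \<in> D \<Longrightarrow> \<bar>(1/\<epsilon>) * f x - a x\<bar> \<le> 2 * C"
        by blast
      have "\<bar>f x - \<epsilon> * a x\<bar> \<le> 2 * C * \<epsilon>" if "x \<in> D" for x
      proof -
        have "\<bar>f x - \<epsilon> * a x\<bar> = \<epsilon> * \<bar>(1/\<epsilon>) * f x - a x\<bar>"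
          using 2 by (simp add: field_simps flip: abs_mult_pos)
        then show ?thesis using mult_left_mono[OF a(2)[OF that], of \<epsilon>] 2 by (simp add: mult_ac)
      qed
      then show ?thesis using Jensen_on_scale[OF a(1), of \<epsilon>] by blast
    qed
  qed
  then show ?thesis
    unfolding sup_dist_on_le_iff by (intro exI[of _ "2 * C"]) blast
qed

end
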